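(* Let $A$ (with values $a,\neg a$) and $C$ (with values $c,\neg c$) be binary variables joined by a link $A\rightarrow C$ quantified by fixed conditional possibilities. Then for all $x\in\{c,\neg c\}$ and $y\in\{a,\neg a\}$: (i) if $\min(\Pi(x\mid y),\Pi(y))>\min(\Pi(x\mid\neg y),\Pi(\neg y))$ and $\Pi(y)<\Pi(x\mid y)$, then $\Pi(x)$ follows $\Pi(y)$; (ii) if $\min(\Pi(x\mid y),\Pi(y))\le\min(\Pi(x\mid\neg y),\Pi(\neg y))$ and $\Pi(y)<\Pi(x\mid y)$, then $\Pi(x)$ may follow $\Pi(y)$ up; (iii) if $\min(\Pi(x\mid y),\Pi(y))>\min(\Pi(x\mid\neg y),\Pi(\neg y))$ and $\Pi(y)\ge\Pi(x\mid y)$, then $\Pi(x)$ may follow $\Pi(y)$ down; (iv) otherwise $\Pi(x)$ is independent of $\Pi(y)$.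
   Context: Convention: $\neg\neg a=a$, $\neg\neg c=c$. The conditional possibilities $\Pi(x\mid y)\in[0,1]$, $x\in\{c,\neg c\}$, $y\in\{a,\neg a\}$, are constants. The possibilities at $C$ are determined from $\Pi(a),\Pi(\neg a)\in[0,1]$ by $$\Pi(x)=\sup\big[\min(\Pi(x\mid a),\Pi(a)),\ \min(\Pi(x\mid\neg a),\Pi(\neg a))\big],\qquad x\in\{c,\neg c\}.$$ The relations below describe how $\Pi(x)$ changes from its current value when $\Pi(y)$ is changed from its current value to another value in $[0,1]$, with $\Pi(\neg y)$ held fixed; the conditions in the claim refer to the current values. Definitions: $\Pi(x)$ *follows* $\Pi(y)$ if $\Pi(x)$ (strictly) increases when $\Pi(y)$ increases and (strictly) decreases when $\Pi(y)$ decreases. $\Pi(x)$ *may follow $\Pi(y)$ up* if, when $\Pi(y)$ increases, $\Pi(x)$ either increases or is unchanged, and, when $\Pi(y)$ decreases, $\Pi(x)$ is unchanged. $\Pi(x)$ *may follow $\Pi(y)$ down* if, when $\Pi(y)$ decreases, $\Pi(x)$ either decreases or is unchanged, and, when $\Pi(y)$ increases, $\Pi(x)$ is unchanged. $\Pi(x)$ is *independent of* $\Pi(y)$ if $\Pi(x)$ does not change as $\Pi(y)$ increases and decreases. *)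

theory Defs
  imports Complex_Main
begin

text \<open>
  The values of a binary variable are encoded as booleans: \<^term>\<open>True\<close> stands for \<open>a\<close>
  (resp. \<open>c\<close>) and \<^term>\<open>False\<close> for \<open>\<not>a\<close> (resp. \<open>\<not>c\<close>), so that the complement of a value
  is boolean negation.  For a link \<open>A \<rightarrow> C\<close>, \<open>cond x y\<close> is the conditional possibility
  \<open>\<Pi>(x | y)\<close> and \<open>pos y\<close> is the current possibility \<open>\<Pi>(y)\<close> at \<open>A\<close>; no normalisation
  such as \<open>max \<Pi>(a) \<Pi>(\<not>a) = 1\<close> is imposed.
\<close>

definition child_poss :: "(bool \<Rightarrow> bool \<Rightarrow> real) \<Rightarrow> (bool \<Rightarrow> real) \<Rightarrow> bool \<Rightarrow> real" where
  "child_poss cond pos x =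
     sup (min (cond x True) (pos True)) (min (cond x False) (pos False))"

text \<open>
  In the relations below \<open>p\<close> is the new value of \<open>\<Pi>(y)\<close>: the update \<open>pos(y := p)\<close> leaves
  \<open>\<Pi>(\<not>y)\<close> as it is.
\<close>

definition follows ::
    "(bool \<Rightarrow> bool \<Rightarrow> real) \<Rightarrow> (bool \<Rightarrow> real) \<Rightarrow> bool \<Rightarrow> bool \<Rightarrow> bool" where
  "follows cond pos x y \<longleftrightarrow>
     (\<forall>p\<in>{0..1}.
        (p > pos y \<longrightarrow> child_poss cond (pos(y := p)) x > child_poss cond pos x) \<and>
        (p < pos y \<longrightarrow> child_poss cond (pos(y := p)) x < child_poss cond pos x))"

definition may_follow_up ::
    "(bool \<Rightarrow> bool \<Rightarrow> real) \<Rightarrow> (bool \<Rightarrow> real) \<Rightarrow> bool \<Rightarrow> bool \<Rightarrow> bool" where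
  "may_follow_up cond pos x y \<longleftrightarrow>
     (\<forall>p\<in>{0..1}.
        (p > pos y \<longrightarrow> child_poss cond (pos(y := p)) x \<ge> child_poss cond pos x) \<and>
        (p < pos y \<longrightarrow> child_poss cond (pos(y := p)) x = child_poss cond pos x))"

definition may_follow_down ::
    "(bool \<Rightarrow> bool \<Rightarrow> real) \<Rightarrow> (bool \<Rightarrow> real) \<Rightarrow> bool \<Rightarrow> bool \<Rightarrow> bool" where
  "may_follow_down cond pos x y \<longleftrightarrow>
     (\<forall>p\<in>{0..1}.
        (p < pos y \<longrightarrow> child_poss cond (pos(y := p)) x \<le> child_poss cond pos x) \<and>
        (p > pos y \<longrightarrow> child_poss cond (pos(y := p)) x = child_poss cond pos x))"

definition independent_of ::
    "(bool \<Rightarrow> bool \<Rightarrow> real) \<Rightarrow> (bool \<Rightarrow> real) \<Rightarrow> bool \<Rightarrow> bool \<Rightarrow> bool" where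
  "independent_of cond pos x y \<longleftrightarrow>
     (\<forall>p\<in>{0..1}. child_poss cond (pos(y := p)) x = child_poss cond pos x)"

end

theory Submission
  imports Defs
begin

text \<open>With \<open>k = cond x y\<close> and
  \<open>m = min (cond x (\<not> y)) (pos (\<not> y))\<close> fixed, the possibility of
  \<open>x\<close> as a function of \<open>p = \<Pi>(y)\<close> is \<open>max (min k p) m\<close>.
  If \<open>m < k\<close>, it is constant up to \<open>m\<close>, has slope one between
  \<open>m\<close> and \<open>k\<close>, and is constant from \<open>k\<close> on; if
  \<open>k \<le> m\<close>, it is constantly \<open>m\<close>. The four cases say where the current
  value lies on this graph. Symmetry of the supremum lets \<open>y\<close> be either value of the
  parent.\<close>

lemma child_poss_split:
  "child_poss cond pos x =
     max (min (cond x y) (pos y)) (min (cond x (\<not> y)) (pos (\<not> y)))"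
  by (cases y) (simp_all add: child_poss_def sup_max max.commute)

text \<open>The update at \<open>y\<close> leaves the value at \<open>\<not> y\<close> alone, so
  \<open>p\<close> enters only the first argument of the maximum.\<close>

lemma child_poss_update:
  "child_poss cond (pos(y := p)) x =
     max (min (cond x y) p) (min (cond x (\<not> y)) (pos (\<not> y)))"
  by (simp add: child_poss_split[of _ _ _ y])

theorem theorem3p2:
  fixes cond :: "bool \<Rightarrow> bool \<Rightarrow> real" and pos :: "bool \<Rightarrow> real"
  assumes cond_range: "\<forall>x y. cond x y \<in> {0..1}"
    and pos_range: "\<forall>y. pos y \<in> {0..1}"
  shows "\<forall>x y.
    (min (cond x y) (pos y) > min (cond x (\<not> y)) (pos (\<not> y)) \<and> pos y < cond x y
       \<longrightarrow> follows cond pos x y) \<and>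
    (min (cond x y) (pos y) \<le> min (cond x (\<not> y)) (pos (\<not> y)) \<and> pos y < cond x y
       \<longrightarrow> may_follow_up cond pos x y) \<and>
    (min (cond x y) (pos y) > min (cond x (\<not> y)) (pos (\<not> y)) \<and> pos y \<ge> cond x y
       \<longrightarrow> may_follow_down cond pos x y) \<and>
    (\<not> (min (cond x y) (pos y) > min (cond x (\<not> y)) (pos (\<not> y)) \<and> pos y < cond x y) \<and>
     \<not> (min (cond x y) (pos y) \<le> min (cond x (\<not> y)) (pos (\<not> y)) \<and> pos y < cond x y) \<and>
     \<not> (min (cond x y) (pos y) > min (cond x (\<not> y)) (pos (\<not> y)) \<and> pos y \<ge> cond x y)
       \<longrightarrow> independent_of cond pos x y)"
proof (intro allI, goal_cases)
  case (1 x y)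
  show ?case
    \<comment> \<open>Old and new values become \<open>max (min k _) m\<close> at
      \<open>pos y\<close> and at \<open>p\<close>, so only order comparisons remain. In the last
      case \<open>k \<le> pos y\<close> and \<open>min k (pos y) \<le> m\<close> give
      \<open>k \<le> m\<close>, so both values are \<open>m\<close>.\<close>
    unfolding follows_def may_follow_up_def may_follow_down_def independent_of_def
      child_poss_update child_poss_split[of cond pos x y]
    by auto
qed

end
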